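(* Non-contravariant class tables describe exactly the context-free forests that have grammars in Greibach normal form: $\mathcal{L}(\mathcal{T}_{\{X,M\}})=\mathrm{NCF}_{\mathrm{GNF}}$.
   Context: Terms. A ranked alphabet is a finite set of symbols, each with a rank in $\mathbb{N}$; $A^{\triangle}$ is the set of finite ground terms (trees) over a ranked alphabet $A$. $X$ is a set of parameters (rank $0$), disjoint from other alphabets; $\tau[\boldsymbol{x}\leftarrow\boldsymbol{t}]$ is simultaneous substitution. Class tables without contravariance. A class table $\Delta$ over a finite set of class names $\Gamma$ consists of one declaration $\gamma(\diamond_1x_1,\dots,\diamond_kx_k):\tau_1,\dots,\tau_m$ ($k,m\ge 0$) for each $\gamma\in\Gamma$, where $k$ is the rank of $\gamma$, the $x_i\in X$ are distinct, $\diamond_i$ is the variance of the $i$-th parameter of $\gamma$, denoted $\mathrm{var}_i(\gamma)$, and the supertypes $\tau_j$ are terms over $\Gamma\cup\{x_1,\dots,x_k\}$, none of which is itself a parameter. In general variances are $\circ$ (invariant), $+$ (covariant) or $-$ (contravariant); in a non-contravariant table all variances are in $\{\circ,+\}$. Ground types are elements of $\Gamma^{\triangle}$. We write $\gamma(\boldsymbol{x}):\tau$ if $\tau$ is one of the declared supertypes of $\gamma$. Inheritance. $\gamma(\boldsymbol{t})\rightarrowtail\tau[\boldsymbol{x}\leftarrow\boldsymbol{t}]$ whenever $\gamma(\boldsymbol{x}):\tau$; $\rightarrowtail^+$ is its transitive closure. Subtyping. $<:$ is the least relation on ground types closed under: (Var) $\gamma(t_1,\dots,t_k)<:\gamma(t_1',\dots,t_k')$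 if for every $i$: $t_i<:t_i'$ when $\mathrm{var}_i(\gamma)=+$, $t_i=t_i'$ when $\mathrm{var}_i(\gamma)=\circ$ (and $t_i'<:t_i$ when $\mathrm{var}_i(\gamma)=-$); (Super) $t<:t''$ if $t\rightarrowtail t'$ and $t'<:t''$. Well-formedness. $\Delta$ is well-formed if (acyclic inheritance) $\gamma(\boldsymbol{\tau})\rightarrowtail^+\gamma'(\boldsymbol{\tau}')$ implies $\gamma\ne\gamma'$; and (valid variance) for each declaration $\gamma(\boldsymbol{\diamond x}):\tau_1,\dots,\tau_m$, $\boldsymbol{\diamond x}\vdash\tau_j$ for all $j$, where $\boldsymbol{\diamond x}\vdash x_i$ iff $\diamond_i\in\{\circ,+\}$, and $\boldsymbol{\diamond x}\vdash\gamma'(\tau'_1,\dots,\tau'_n)$ iff for all $i$: $\mathrm{var}_i(\gamma')\in\{\circ,+\}$ implies $\boldsymbol{\diamond x}\vdash\tau'_i$, and $\mathrm{var}_i(\gamma')\in\{\circ,-\}$ implies $\neg\boldsymbol{\diamond x}\vdash\tau'_i$; here $\neg\boldsymbol{\diamond x}$ swaps $+$ and $-$ and leaves $\circ$ fixed. Type system $\mathcal{T}_{\{X,M\}}$. A class table $\Delta$ conforms to $\mathcal{T}_{\{X,M\}}$, written $\mathcal{T}_{\{X,M\}}\vdash\Delta$, if it is well-formed and no parameter of any class is contravariant (expansive inheritance and multiple instantiation inheritance are both allowed, i.e., there is no further restriction). Languages. For a class table $\Delta$ over $\Gamma$, a ground type $t_\bot\in\Gamma^{\triangle}$ and a super-alphabet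 $\Sigma_\top\subseteq\Gamma$, $L_{t_\bot}(\Delta)=\{t_\top\in\Sigma_\top^{\triangle}\mid t_\bot<:t_\top\}$. $\mathcal{L}(\mathcal{T}_{\{X,M\}})$ is the class of all forests $L_{t_\bot}(\Delta)$ with $\mathcal{T}_{\{X,M\}}\vdash\Delta$ (over all choices of $\Gamma,\Delta,t_\bot,\Sigma_\top$). Context-free forests in GNF. A context-free tree grammar is $G=\langle\Sigma,V,v_0,R\rangle$ with $\Sigma$ a finite ranked alphabet, $V$ a finite ranked set of variables disjoint from $\Sigma$, $v_0\in V$ of rank $0$, and $R$ a finite set of productions $v(x_1,\dots,x_k)::=\tau$ with $v\in V$ of rank $k$, distinct parameters $x_i$, and $\tau$ a term over $\Sigma\cup V\cup\{x_1,\dots,x_k\}$. It is in Greibach normal form (GNF) if every right-hand side has a terminal root, i.e., is of the form $\sigma(\tau_1,\dots,\tau_n)$ with $\sigma\in\Sigma$. One derivation step $t\to_Gt'$ replaces one subtree $v(t_1,\dots,t_k)$ of $t\in(\Sigma\cup V)^{\triangle}$ by $\tau[x_1\leftarrow t_1,\dots,x_k\leftarrow t_k]$ for a production $v(x_1,\dots,x_k)::=\tau$; $L(G)=\{t\in\Sigma^{\triangle}\mid v_0\to_G^*t\}$. $\mathrm{NCF}_{\mathrm{GNF}}$ is the class of forests $L(G)$, $G$ a context-free tree grammar in GNF. *)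

theory Defs
  imports Main "HOL-Library.Infinite_Typeclass"
begin

section \<open>Ranked alphabets and terms\<close>

text \<open>A ranked alphabet is a partial map from symbols to ranks with finite domain. Since
  \<open>A \<subseteq>\<^sub>m B\<close> compares ranks as well, it expresses inclusion of ranked alphabets. All alphabets
  draw their symbols from one type \<open>'a\<close>, which has to be infinite wherever fresh symbols
  may be needed.\<close>

type_synonym 'a alphabet = "'a \<rightharpoonup> nat"

definition ranked_alphabet :: "'a alphabet \<Rightarrow> bool" where
  "ranked_alphabet A \<longleftrightarrow> finite (dom A)"

text \<open>Parameters are positional: in a declaration or production with \<open>k\<close> parameters,
  \<open>Par 0, \<dots>, Par (k - 1)\<close> stand for the distinct parameters \<open>x\<^sub>1, \<dots>, x\<^sub>k\<close>, and lists
  are indexed from 0 accordingly.\<close>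

datatype 'a trm = Par nat | App 'a "'a trm list"

text \<open>The well-ranked terms over \<open>A \<union> {x\<^sub>1, \<dots>, x\<^sub>k}\<close>.\<close>

inductive_set terms :: "'a alphabet \<Rightarrow> nat \<Rightarrow> 'a trm set" for A :: "'a alphabet" and k :: nat where
  Par: "i < k \<Longrightarrow> Par i \<in> terms A k"
| App: "A f = Some (length ts) \<Longrightarrow> (\<And>t. t \<in> set ts \<Longrightarrow> t \<in> terms A k) \<Longrightarrow> App f ts \<in> terms A k"

abbreviation ground_terms :: "'a alphabet \<Rightarrow> 'a trm set" where
  "ground_terms A \<equiv> terms A 0"

primrec subst :: "'a trm list \<Rightarrow> 'a trm \<Rightarrow> 'a trm" where
  "subst ts (Par i) = (if i < length ts then ts ! i else Par i)"
| "subst ts (App f us) = App f (map (subst ts) us)"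

section \<open>Class tables\<close>

datatype variance = Invariant | Covariant | Contravariant

record 'a decl =
  variances :: "variance list"
  supertypes :: "'a trm list"

type_synonym 'a class_table = "'a \<rightharpoonup> 'a decl"

definition classes :: "'a class_table \<Rightarrow> 'a alphabet" where
  "classes \<Delta> = (\<lambda>\<gamma>. map_option (\<lambda>d. length (variances d)) (\<Delta> \<gamma>))"

definition var :: "'a class_table \<Rightarrow> 'a \<Rightarrow> nat \<Rightarrow> variance" where
  "var \<Delta> \<gamma> i = variances (the (\<Delta> \<gamma>)) ! i"

definition class_table :: "'a class_table \<Rightarrow> bool" where
  "class_table \<Delta> \<longleftrightarrow>
     ranked_alphabet (classes \<Delta>) \<and>
     (\<forall>\<gamma> d. \<Delta> \<gamma> = Some d \<longrightarrow>
        (\<forall>\<tau> \<in> set (supertypes d).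
           \<tau> \<in> terms (classes \<Delta>) (length (variances d)) \<and> (\<forall>i. \<tau> \<noteq> Par i)))"

text \<open>Inheritance relates all types, including those with parameters; the subtyping
  rules below only use it on ground types.\<close>

inductive inherits :: "'a class_table \<Rightarrow> 'a trm \<Rightarrow> 'a trm \<Rightarrow> bool" for \<Delta> :: "'a class_table" where
  "\<Delta> \<gamma> = Some d \<Longrightarrow> \<tau> \<in> set (supertypes d) \<Longrightarrow> App \<gamma> ts \<in> (\<Union>n. terms (classes \<Delta>) n) \<Longrightarrow>
     inherits \<Delta> (App \<gamma> ts) (subst ts \<tau>)"

inductive subtype :: "'a class_table \<Rightarrow> 'a trm \<Rightarrow> 'a trm \<Rightarrow> bool" for \<Delta> :: "'a class_table" where
  Var: "App \<gamma> ts \<in> ground_terms (classes \<Delta>) \<Longrightarrow> App \<gamma> ts' \<in> ground_terms (classes \<Delta>) \<Longrightarrow>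
     (\<forall>i < length ts.
        (var \<Delta> \<gamma> i = Covariant \<longrightarrow> subtype \<Delta> (ts ! i) (ts' ! i)) \<and>
        (var \<Delta> \<gamma> i = Invariant \<longrightarrow> ts ! i = ts' ! i) \<and>
        (var \<Delta> \<gamma> i = Contravariant \<longrightarrow> subtype \<Delta> (ts' ! i) (ts ! i))) \<Longrightarrow>
     subtype \<Delta> (App \<gamma> ts) (App \<gamma> ts')"
| Super: "t \<in> ground_terms (classes \<Delta>) \<Longrightarrow> inherits \<Delta> t t' \<Longrightarrow> subtype \<Delta> t' t'' \<Longrightarrow>
     subtype \<Delta> t t''"

definition acyclic_inheritance :: "'a class_table \<Rightarrow> bool" where
  "acyclic_inheritance \<Delta> \<longleftrightarrow>
     (\<forall>\<gamma> ts \<gamma>' ts'. (inherits \<Delta>)\<^sup>+\<^sup>+ (App \<gamma> ts) (App \<gamma>' ts') \<longrightarrow> \<gamma> \<noteq> \<gamma>')"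

primrec flip :: "variance \<Rightarrow> variance" where
  "flip Invariant = Invariant"
| "flip Covariant = Contravariant"
| "flip Contravariant = Covariant"

text \<open>\<open>valid_type \<Delta> vs \<tau>\<close> is the judgement \<open>\<diamond>x \<turnstile> \<tau>\<close>, where \<open>vs\<close> lists the variances of the
  parameters. The negation in \<open>\<not>\<diamond>x \<turnstile> \<tau>\<close> applies to the variances, not to the judgement.\<close>

function (sequential) valid_type :: "'a class_table \<Rightarrow> variance list \<Rightarrow> 'a trm \<Rightarrow> bool" where
  "valid_type \<Delta> vs (Par i) \<longleftrightarrow> i < length vs \<and> vs ! i \<in> {Invariant, Covariant}"
| "valid_type \<Delta> vs (App \<gamma> ts) \<longleftrightarrow>
     (\<forall>i \<in> {..<length ts}.
        (var \<Delta> \<gamma> i \<in> {Invariant, Covariant} \<longrightarrow> valid_type \<Delta> vs (ts ! i)) \<and>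
        (var \<Delta> \<gamma> i \<in> {Invariant, Contravariant} \<longrightarrow> valid_type \<Delta> (map flip vs) (ts ! i)))"
  by pat_completeness auto
termination
  by (relation "measure (\<lambda>(\<Delta>, vs, t). size t)")
    (auto simp: less_Suc_eq_le intro: size_list_estimation' nth_mem)

definition valid_variance :: "'a class_table \<Rightarrow> bool" where
  "valid_variance \<Delta> \<longleftrightarrow>
     (\<forall>\<gamma> d. \<Delta> \<gamma> = Some d \<longrightarrow> (\<forall>\<tau> \<in> set (supertypes d). valid_type \<Delta> (variances d) \<tau>))"

definition well_formed :: "'a class_table \<Rightarrow> bool" where
  "well_formed \<Delta> \<longleftrightarrow> class_table \<Delta> \<and> acyclic_inheritance \<Delta> \<and> valid_variance \<Delta>"

text \<open>The type system \<open>\<T>\<^bsub>{X,M}\<^esub>\<close>: expansive inheritance and multiple instantiation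
  inheritance are allowed, contravariance is not.\<close>

definition conforms_XM :: "'a class_table \<Rightarrow> bool" where
  "conforms_XM \<Delta> \<longleftrightarrow>
     well_formed \<Delta> \<and> (\<forall>\<gamma> d. \<Delta> \<gamma> = Some d \<longrightarrow> Contravariant \<notin> set (variances d))"

definition supertype_forest :: "'a class_table \<Rightarrow> 'a trm \<Rightarrow> 'a alphabet \<Rightarrow> 'a trm set" where
  "supertype_forest \<Delta> t_bot \<Sigma>_top = {t_top \<in> ground_terms \<Sigma>_top. subtype \<Delta> t_bot t_top}"

definition forests_XM :: "'a trm set set" where
  "forests_XM = {supertype_forest \<Delta> t_bot \<Sigma>_top | \<Delta> t_bot \<Sigma>_top.
     conforms_XM \<Delta> \<and> t_bot \<in> ground_terms (classes \<Delta>) \<and> \<Sigma>_top \<subseteq>\<^sub>m classes \<Delta>}"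

section \<open>Context-free tree grammars\<close>

text \<open>The pair \<open>(v, \<tau>)\<close> represents the production \<open>v(x\<^sub>1, \<dots>, x\<^sub>k) ::= \<tau>\<close>, with \<open>k\<close> the rank
  of \<open>v\<close>.\<close>

record 'a grammar =
  terminals :: "'a alphabet"
  variables :: "'a alphabet"
  start :: 'a
  productions :: "('a \<times> 'a trm) set"

abbreviation symbols :: "'a grammar \<Rightarrow> 'a alphabet" where
  "symbols G \<equiv> terminals G ++ variables G"

definition context_free_tree_grammar :: "'a grammar \<Rightarrow> bool" where
  "context_free_tree_grammar G \<longleftrightarrow>
     ranked_alphabet (terminals G) \<and> ranked_alphabet (variables G) \<and>
     dom (terminals G) \<inter> dom (variables G) = {} \<and>
     variables G (start G) = Some 0 \<and>
     finite (productions G) \<and>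
     (\<forall>(v, \<tau>) \<in> productions G. \<exists>k. variables G v = Some k \<and> \<tau> \<in> terms (symbols G) k)"

definition greibach_normal_form :: "'a grammar \<Rightarrow> bool" where
  "greibach_normal_form G \<longleftrightarrow>
     (\<forall>(v, \<tau>) \<in> productions G. \<exists>\<sigma> ts. \<sigma> \<in> dom (terminals G) \<and> \<tau> = App \<sigma> ts)"

inductive derives :: "'a grammar \<Rightarrow> 'a trm \<Rightarrow> 'a trm \<Rightarrow> bool" for G :: "'a grammar" where
  root: "(v, \<tau>) \<in> productions G \<Longrightarrow> App v ts \<in> ground_terms (symbols G) \<Longrightarrow>
     derives G (App v ts) (subst ts \<tau>)"
| arg: "derives G t t' \<Longrightarrow> App f (ls @ t # rs) \<in> ground_terms (symbols G) \<Longrightarrow>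
     derives G (App f (ls @ t # rs)) (App f (ls @ t' # rs))"

definition grammar_forest :: "'a grammar \<Rightarrow> 'a trm set" where
  "grammar_forest G = {t \<in> ground_terms (terminals G). (derives G)\<^sup>*\<^sup>* (App (start G) []) t}"

definition NCF_GNF :: "'a trm set set" where
  "NCF_GNF = {grammar_forest G | G. context_free_tree_grammar G \<and> greibach_normal_form G}"

end

theory Submission
  imports Defs
begin

text \<open>A grammar in Greibach normal form is read as a class table in which all parameters are
  covariant and the right-hand sides for \<open>v\<close> are the supertypes of the class \<open>v\<close>: deriving a
  terminal tree from \<open>t\<close> is then the same thing as finding a supertype of \<open>t\<close> over the terminals.
  The normal form makes inheritance acyclic, since it only leads from variables to terminals.

  Conversely, a type \<open>\<gamma>(t\<^sub>1, \<dots>, t\<^sub>k)\<close> is turned into a tree generating its supertypes, with a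
  variable for \<open>\<gamma>\<close> that receives each argument twice: as a tree generating \<open>t\<^sub>i\<close> only, to be used
  in invariant positions, and as a tree generating all supertypes of \<open>t\<^sub>i\<close>, to be used in covariant
  positions. The productions of this variable come from all the types inherited, in any number
  of steps, by \<open>\<gamma>(x\<^sub>1, \<dots>, x\<^sub>k)\<close>; acyclicity of inheritance makes them finitely many.\<close>

section \<open>Terms and substitution\<close>

lemma App_in_terms_iff [simp]:
  "App f ts \<in> terms A k \<longleftrightarrow> A f = Some (length ts) \<and> (\<forall>t \<in> set ts. t \<in> terms A k)"
  by (auto intro: terms.App elim: terms.cases)

lemma Par_in_terms_iff [simp]: "Par i \<in> terms A k \<longleftrightarrow> i < k"
  by (auto intro: terms.Par elim: terms.cases)

lemma ground_termsE:
  assumes "t \<in> ground_terms A"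
  obtains f ts where "t = App f ts" "A f = Some (length ts)" "\<forall>t \<in> set ts. t \<in> ground_terms A"
  using assms by cases auto

lemma terms_mono:
  assumes "A \<subseteq>\<^sub>m B" "t \<in> terms A k"
  shows "t \<in> terms B k"
  using assms(2)
proof induction
  case (App f ts)
  with assms(1) have "B f = Some (length ts)"
    by (metis domI map_le_def)
  with App show ?case by simp
qed simp

lemma subst_in_terms:
  assumes "\<tau> \<in> terms A (length ts)" "\<forall>t \<in> set ts. t \<in> terms A n"
  shows "subst ts \<tau> \<in> terms A n"
  using assms by (induction rule: terms.induct) auto

text \<open>\<open>subst\<close> leaves parameters beyond its list unchanged, so bounding the
  parameters of \<open>\<tau>\<close> is what keeps \<open>ts\<close> from acting on leftover
  parameters of \<open>subst us \<tau>\<close>.\<close>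

lemma subst_subst:
  assumes "\<tau> \<in> terms A (length us)"
  shows "subst ts (subst us \<tau>) = subst (map (subst ts) us) \<tau>"
  using assms by (induction rule: terms.induct) auto

lemma subst_Nil [simp]: "subst [] t = t"
  by (induction t) (auto intro: map_idI)

lemma map_subst_Par_upt [simp]: "map (subst ts) (map Par [0..<length ts]) = ts"
  by (auto intro: nth_equalityI)

section \<open>Derivations of terminal trees\<close>

text \<open>Big-step, outermost-first derivation: a variable at the root is expanded with its
  arguments still underived, and below a terminal root the arguments are derived independently. The
  rules mirror \<open>Var\<close> and \<open>Super\<close> of subtyping.\<close>

inductive generates :: "'a grammar \<Rightarrow> 'a trm \<Rightarrow> 'a trm \<Rightarrow> bool" for G :: "'a grammar" where
  term_root: "f \<in> dom (terminals G) \<Longrightarrow> list_all2 (generates G) ts ts' \<Longrightarrow>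
     generates G (App f ts) (App f ts')"
| var_root: "(v, \<tau>) \<in> productions G \<Longrightarrow> generates G (subst ts \<tau>) t' \<Longrightarrow>
     generates G (App v ts) t'"

lemma generates_refl: "t \<in> ground_terms (terminals G) \<Longrightarrow> generates G t t"
  by (induction rule: terms.induct) (auto intro!: generates.term_root list.rel_refl_strong)

locale cf_grammar =
  fixes G :: "'a grammar"
  assumes cf: "context_free_tree_grammar G"
begin

lemma productionD:
  assumes "(v, \<tau>) \<in> productions G"
  obtains k where "variables G v = Some k" "symbols G v = Some k" "\<tau> \<in> terms (symbols G) k"
    "v \<notin> dom (terminals G)"
  using assms cf unfolding context_free_tree_grammar_def by fastforce

lemma generates_terminal_iff:
  assumes "f \<in> dom (terminals G)"
  shows "generates G (App f ts) t' \<longleftrightarrow> (\<exists>ts'. t' = App f ts' \<and> list_all2 (generates G) ts ts')"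
  using assms by (auto elim: generates.cases productionD intro: generates.term_root)

lemma generates_variable_iff:
  assumes "v \<notin> dom (terminals G)"
  shows "generates G (App v ts) t' \<longleftrightarrow> (\<exists>\<tau>. (v, \<tau>) \<in> productions G \<and> generates G (subst ts \<tau>) t')"
  using assms by (auto elim: generates.cases intro: generates.var_root)

section \<open>Agreement of stepwise derivation with \<open>generates\<close>\<close>

lemma derives_in_ground_terms:
  assumes "derives G t t'" "t \<in> ground_terms (symbols G)"
  shows "t' \<in> ground_terms (symbols G)"
  using assms
proof induction
  case (root v \<tau> ts)
  from root(1) obtain k where "symbols G v = Some k" "\<tau> \<in> terms (symbols G) k"
    by (rule productionD)
  with root show ?case by (auto intro: subst_in_terms)
qed auto

lemma derives_rtranclp_in_ground_terms:
  "(derives G)\<^sup>*\<^sup>* t t' \<Longrightarrow> t \<in> ground_terms (symbols G) \<Longrightarrow> t' \<in> ground_terms (symbols G)"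
  by (induction rule: rtranclp_induct) (auto intro: derives_in_ground_terms)

lemma derives_rtranclp_arg:
  assumes "(derives G)\<^sup>*\<^sup>* t t'" "App f (ls @ t # rs) \<in> ground_terms (symbols G)"
  shows "(derives G)\<^sup>*\<^sup>* (App f (ls @ t # rs)) (App f (ls @ t' # rs))"
  using assms(1)
proof (induction rule: rtranclp_induct)
  case (step u u')
  have "u \<in> ground_terms (symbols G)"
    using step(1) assms(2) by (auto intro: derives_rtranclp_in_ground_terms)
  with assms(2) step(2) have "derives G (App f (ls @ u # rs)) (App f (ls @ u' # rs))"
    by (intro derives.arg) auto
  with step.IH show ?case by (rule rtranclp.rtrancl_into_rtrancl)
qed simp

text \<open>Arguments are derived from left to right; \<open>ls\<close> collects the finished ones
  and grows during the induction.\<close>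

lemma derives_rtranclp_args:
  assumes "list_all2 (derives G)\<^sup>*\<^sup>* rs rs'" "App f (ls @ rs) \<in> ground_terms (symbols G)"
  shows "(derives G)\<^sup>*\<^sup>* (App f (ls @ rs)) (App f (ls @ rs'))"
  using assms
proof (induction arbitrary: ls rule: list_all2_induct)
  case (Cons t ts t' ts')
  have "(derives G)\<^sup>*\<^sup>* (App f (ls @ t # ts)) (App f (ls @ t' # ts))"
    using Cons by (intro derives_rtranclp_arg) auto
  moreover have "t' \<in> ground_terms (symbols G)"
    using Cons.hyps Cons.prems by (auto intro: derives_rtranclp_in_ground_terms)
  then have "(derives G)\<^sup>*\<^sup>* (App f ((ls @ [t']) @ ts)) (App f ((ls @ [t']) @ ts'))"
    using Cons.prems by (intro Cons.IH) auto
  ultimately show ?case by simp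
qed simp

lemma generates_imp_derives:
  assumes "generates G t t'" "t \<in> ground_terms (symbols G)"
  shows "(derives G)\<^sup>*\<^sup>* t t'"
  using assms
proof induction
  case (term_root f ts ts')
  have "list_all2 (derives G)\<^sup>*\<^sup>* ts ts'"
    using term_root by (auto simp: list_all2_conv_all_nth)
  with term_root(3) show ?case
    using derives_rtranclp_args[of ts ts' f "[]"] by simp
next
  case (var_root v \<tau> ts t')
  have "derives G (App v ts) (subst ts \<tau>)"
    using var_root by (intro derives.root)
  moreover from this have "(derives G)\<^sup>*\<^sup>* (subst ts \<tau>) t'"
    using var_root derives_in_ground_terms by blast
  ultimately show ?case by (rule converse_rtranclp_into_rtranclp)
qed

text \<open>An argument may be copied, and its copies may generate different trees. The hypothesis
  therefore compares all that the arguments generate, and the induction on the derivation lets the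
  pattern \<open>\<tau>\<close> vary.\<close>

lemma generates_subst_mono:
  assumes "generates G (subst us \<tau>) s" "\<tau> \<in> terms (symbols G) (length us)"
    and "length ts = length us"
    and "\<And>i s. i < length us \<Longrightarrow> generates G (us ! i) s \<Longrightarrow> generates G (ts ! i) s"
  shows "generates G (subst ts \<tau>) s"
  using assms(1,2)
proof (induction "subst us \<tau>" s arbitrary: \<tau> rule: generates.induct)
  case (term_root f vs vs')
  show ?case
  proof (cases \<tau>)
    \<comment> \<open>Here the whole derivation takes place inside one argument; it is reassembled
      from its premises so that the hypothesis on \<open>us\<close> and \<open>ts\<close>
      applies.\<close>
    case (Par i)
    have "generates G (App f vs) (App f vs')"
      using term_root by (intro generates.term_root) (auto elim: list.rel_mono_strong)
    with Par term_root have "generates G (us ! i) (App f vs')" by simp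
    with Par term_root assms(3,4) show ?thesis by auto
  next
    case (App g ws)
    with term_root have "list_all2 (generates G) (map (subst ts) ws) vs'"
      by (auto simp: list_all2_conv_all_nth)
    with App term_root show ?thesis by (auto intro: generates.term_root)
  qed
next
  case (var_root v \<rho> vs t')
  show ?case
  proof (cases \<tau>)
    case (Par i)
    have "generates G (App v vs) t'"
      using var_root(1,2) by (rule generates.var_root)
    with Par var_root have "generates G (us ! i) t'" by simp
    with Par var_root assms(3,4) show ?thesis by auto
  next
    case (App g ws)
    with var_root have [simp]: "g = v" "vs = map (subst us) ws" by auto
    from var_root(1) obtain k where "symbols G v = Some k" "\<rho> \<in> terms (symbols G) k"
      by (rule productionD)
    \<comment> \<open>Expanding the variable gives an instance of another pattern over the same
      parameters, \<open>subst ws \<rho>\<close>, to which the induction hypothesis applies.\<close>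
    with App var_root(5) have \<rho>: "\<rho> \<in> terms (symbols G) (length ws)" by simp
    then have "subst ws \<rho> \<in> terms (symbols G) (length us)"
      using App var_root(5) by (auto intro: subst_in_terms)
    moreover have "subst vs \<rho> = subst us (subst ws \<rho>)"
      using subst_subst[OF \<rho>] by simp
    ultimately have "generates G (subst ts (subst ws \<rho>)) t'"
      using var_root(3) by blast
    then show ?thesis
      using App var_root(1) subst_subst[OF \<rho>] by (auto intro: generates.var_root)
  qed
qed

text \<open>\<open>derives\<close> may rewrite below a variable, which \<open>generates\<close>
  never does. Such a step is postponed: the production at the root is applied first, and
  \<open>generates_subst_mono\<close> handles all copies of the rewritten argument at once.\<close>

lemma derives_generates:
  assumes "derives G t u" "generates G u s"
  shows "generates G t s"
  using assms
proof (induction arbitrary: s)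
  case (root v \<tau> ts)
  then show ?case by (auto intro: generates.var_root)
next
  case (arg t u f ls rs)
  from arg.prems show ?case
  proof cases
    case (term_root ts')
    with arg.IH show ?thesis
      by (auto simp: list_all2_append1 list_all2_Cons1 intro!: generates.term_root list_all2_appendI)
  next
    case (var_root \<tau>)
    from var_root(1) obtain k where "symbols G f = Some k" "\<tau> \<in> terms (symbols G) k"
      by (rule productionD)
    with arg.hyps have \<tau>: "\<tau> \<in> terms (symbols G) (length (ls @ u # rs))" by simp
    have "generates G (subst (ls @ t # rs) \<tau>) s"
      using var_root(2) \<tau>
    proof (rule generates_subst_mono)
      fix i s assume "generates G ((ls @ u # rs) ! i) s"
      with arg.IH show "generates G ((ls @ t # rs) ! i) s"
        by (cases "i = length ls") (auto simp: nth_append nth_Cons')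
    qed simp
    with var_root(1) show ?thesis by (rule generates.var_root)
  qed
qed

lemma derives_iff_generates:
  assumes "t \<in> ground_terms (symbols G)" "t' \<in> ground_terms (terminals G)"
  shows "(derives G)\<^sup>*\<^sup>* t t' \<longleftrightarrow> generates G t t'"
proof
  assume "(derives G)\<^sup>*\<^sup>* t t'"
  then show "generates G t t'"
    using assms(2)
    by (induction rule: converse_rtranclp_induct) (auto intro: generates_refl derives_generates)
qed (use assms generates_imp_derives in blast)

lemma grammar_forest_generates:
  "grammar_forest G = {t \<in> ground_terms (terminals G). generates G (App (start G) []) t}"
proof -
  have "App (start G) [] \<in> ground_terms (symbols G)"
    using cf by (simp add: context_free_tree_grammar_def)
  then show ?thesis
    unfolding grammar_forest_def using derives_iff_generates by blast
qed

end

section \<open>Grammars as class tables\<close>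

text \<open>Right-hand sides form a set but supertypes a list, so \<open>SOME\<close> picks an
  enumeration, which exists by finiteness of the productions. Terminals have no productions and
  become classes without supertypes.\<close>

definition grammar_table :: "'a grammar \<Rightarrow> 'a class_table" where
  "grammar_table G = (\<lambda>f. map_option (\<lambda>k. \<lparr>variances = replicate k Covariant,
     supertypes = (SOME ts. set ts = {\<tau>. (f, \<tau>) \<in> productions G})\<rparr>) (symbols G f))"

locale gnf_grammar = cf_grammar +
  assumes gnf: "greibach_normal_form G"
begin

lemma classes_grammar_table [simp]: "classes (grammar_table G) = symbols G"
  by (auto simp: classes_def grammar_table_def option.map_comp o_def option.map_ident)

lemma grammar_table_SomeD:
  assumes "grammar_table G f = Some d"
  shows "symbols G f = Some (length (variances d))"
    and "variances d = replicate (length (variances d)) Covariant"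
    and "set (supertypes d) = {\<tau>. (f, \<tau>) \<in> productions G}"
proof -
  have "{\<tau>. (f, \<tau>) \<in> productions G} \<subseteq> snd ` productions G" by force
  then have "finite {\<tau>. (f, \<tau>) \<in> productions G}"
    using cf by (auto simp: context_free_tree_grammar_def intro: finite_subset)
  then have "set (SOME ts. set ts = {\<tau>. (f, \<tau>) \<in> productions G}) = {\<tau>. (f, \<tau>) \<in> productions G}"
    by (metis (mono_tags, lifting) finite_list someI_ex)
  with assms show "set (supertypes d) = {\<tau>. (f, \<tau>) \<in> productions G}"
    by (auto simp: grammar_table_def)
next
  from assms obtain k where "symbols G f = Some k" "variances d = replicate k Covariant"
    unfolding grammar_table_def map_option_eq_Some by (metis decl.select_convs(1))
  then show "symbols G f = Some (length (variances d))"
    "variances d = replicate (length (variances d)) Covariant"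
    by (metis length_replicate)+
qed

lemma var_grammar_table:
  assumes "symbols G f = Some k" "i < k"
  shows "var (grammar_table G) f i = Covariant"
  using assms by (auto simp: var_def grammar_table_def)

lemma inherits_grammar_table_iff:
  "inherits (grammar_table G) t t' \<longleftrightarrow>
     (\<exists>v ts \<tau> n. t = App v ts \<and> t' = subst ts \<tau> \<and> (v, \<tau>) \<in> productions G \<and>
       App v ts \<in> terms (symbols G) n)"
    (is "_ \<longleftrightarrow> ?R")
proof
  assume "inherits (grammar_table G) t t'"
  then show ?R
    by cases (use grammar_table_SomeD(3) in auto)
next
  assume ?R
  then obtain v ts \<tau> n where *: "t = App v ts" "t' = subst ts \<tau>" "(v, \<tau>) \<in> productions G"
    "App v ts \<in> terms (symbols G) n"
    by blast
  then obtain d where "grammar_table G v = Some d"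
    by (auto simp: grammar_table_def)
  moreover from this have "\<tau> \<in> set (supertypes d)"
    using * grammar_table_SomeD(3) by simp
  moreover have "App v ts \<in> (\<Union>n. terms (classes (grammar_table G)) n)"
    unfolding classes_grammar_table using * by blast
  ultimately show "inherits (grammar_table G) t t'"
    using * inherits.intros by metis
qed

section \<open>Conformance of the table to the type system\<close>

lemma production_head:
  assumes "(v, \<tau>) \<in> productions G"
  obtains f ts where "\<tau> = App f ts" "f \<in> dom (terminals G)"
  using gnf assms by (fastforce simp: greibach_normal_form_def)

text \<open>With every position covariant, the variance list is never flipped.\<close>

lemma valid_type_Covariant:
  assumes "\<tau> \<in> terms (symbols G) k"
  shows "valid_type (grammar_table G) (replicate k Covariant) \<tau>"
  using assms by (induction rule: terms.induct) (auto simp: var_grammar_table)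

lemma acyclic_grammar_table: "acyclic_inheritance (grammar_table G)"
  unfolding acyclic_inheritance_def
proof (intro allI impI)
  fix f g ts us
  assume "(inherits (grammar_table G))\<^sup>+\<^sup>+ (App f ts) (App g us)"
  \<comment> \<open>Only the ends of the chain matter: its first step starts at a variable, its last
    one ends at a terminal.\<close>
  then obtain t t' where "inherits (grammar_table G) (App f ts) t"
    "inherits (grammar_table G) t' (App g us)"
    by (metis tranclpD rtranclpD tranclp.cases)
  then have "f \<notin> dom (terminals G)" "g \<in> dom (terminals G)"
    unfolding inherits_grammar_table_iff
    by (auto elim: productionD, auto elim: production_head)
  then show "f \<noteq> g" by blast
qed

lemma conforms_grammar_table: "conforms_XM (grammar_table G)"
proof -
  have "class_table (grammar_table G)"
    unfolding class_table_def classes_grammar_table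
  proof (intro conjI allI impI ballI)
    show "ranked_alphabet (symbols G)"
      using cf by (simp add: context_free_tree_grammar_def ranked_alphabet_def)
  next
    fix f d \<tau> i assume d: "grammar_table G f = Some d" "\<tau> \<in> set (supertypes d)"
    then have p: "(f, \<tau>) \<in> productions G" using grammar_table_SomeD by auto
    with d show "\<tau> \<in> terms (symbols G) (length (variances d))"
      using grammar_table_SomeD(1)[OF d(1)] by (auto elim: productionD)
    from p show "\<tau> \<noteq> Par i" by (auto elim: production_head)
  qed
  moreover have "valid_variance (grammar_table G)"
    unfolding valid_variance_def
  proof (intro allI impI ballI)
    fix f d \<tau> assume d: "grammar_table G f = Some d" "\<tau> \<in> set (supertypes d)"
    then have "(f, \<tau>) \<in> productions G" using grammar_table_SomeD by auto
    then have "\<tau> \<in> terms (symbols G) (length (variances d))"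
      using grammar_table_SomeD(1)[OF d(1)] by (auto elim: productionD)
    then show "valid_type (grammar_table G) (variances d) \<tau>"
      using valid_type_Covariant grammar_table_SomeD(2)[OF d(1)] by metis
  qed
  moreover have "Contravariant \<notin> set (variances d)" if "grammar_table G f = Some d" for f d
    using grammar_table_SomeD(2)[OF that]
    by (metis in_set_replicate variance.distinct(6))
  ultimately show ?thesis
    using acyclic_grammar_table by (auto simp: conforms_XM_def well_formed_def)
qed

text \<open>\<open>Var\<close> turns into \<open>term_root\<close> and \<open>Super\<close> into
  \<open>var_root\<close>. A target over the terminals rules out \<open>Var\<close> at a variable,
  which has no counterpart in \<open>generates\<close>.\<close>

lemma subtype_imp_generates:
  assumes "subtype (grammar_table G) t t'" "t' \<in> ground_terms (terminals G)"
  shows "generates G t t'"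
  using assms
proof induction
  case (Var f ts ts')
  then have "length ts = length ts'" "f \<in> dom (terminals G)" by auto
  with Var show ?case
    by (auto intro!: generates.term_root simp: list_all2_conv_all_nth var_grammar_table)
next
  case (Super t t' t'')
  then show ?case
    by (auto simp: inherits_grammar_table_iff intro: generates.var_root)
qed

text \<open>\<open>generates\<close> does not check ranks, whereas the subtyping rules demand ground
  types; hence both trees are assumed well-ranked.\<close>

lemma generates_imp_subtype:
  assumes "generates G t t'" "t' \<in> ground_terms (terminals G)" "t \<in> ground_terms (symbols G)"
  shows "subtype (grammar_table G) t t'"
  using assms
proof induction
  case (term_root f ts ts')
  have "terminals G \<subseteq>\<^sub>m symbols G"
    using cf by (auto simp: context_free_tree_grammar_def map_le_iff_map_add_commute
        intro!: map_add_comm[THEN trans])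
  with term_root(3) have "App f ts' \<in> ground_terms (symbols G)"
    using terms_mono by blast
  with term_root show ?case
    by (intro subtype.Var) (auto simp: list_all2_conv_all_nth var_grammar_table)
next
  case (var_root v \<tau> ts t')
  from var_root(1) obtain k where "symbols G v = Some k" "\<tau> \<in> terms (symbols G) k"
    by (rule productionD)
  with var_root have "subst ts \<tau> \<in> ground_terms (symbols G)"
    by (auto intro: subst_in_terms)
  with var_root have "subtype (grammar_table G) (subst ts \<tau>) t'" by blast
  moreover have "inherits (grammar_table G) (App v ts) (subst ts \<tau>)"
    using var_root inherits_grammar_table_iff by blast
  moreover have "App v ts \<in> ground_terms (classes (grammar_table G))"
    using var_root.prems(2) by simp
  ultimately show ?case
    by (metis subtype.Super)
qed

lemma grammar_forest_in_forests_XM: "grammar_forest G \<in> forests_XM"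
proof -
  have start: "App (start G) [] \<in> ground_terms (symbols G)"
    and le: "terminals G \<subseteq>\<^sub>m symbols G"
    using cf by (auto simp: context_free_tree_grammar_def map_le_iff_map_add_commute
        intro!: map_add_comm[THEN trans])
  have "grammar_forest G = supertype_forest (grammar_table G) (App (start G) []) (terminals G)"
    unfolding grammar_forest_generates supertype_forest_def
    using start subtype_imp_generates generates_imp_subtype by blast
  then show ?thesis
    unfolding forests_XM_def using conforms_grammar_table start le by fastforce
qed

end

section \<open>Inheritance and subtyping without contravariance\<close>

locale noncontravariant_table =
  fixes \<Delta> :: "'a class_table"
  assumes conforms: "conforms_XM \<Delta>"
begin

abbreviation inherits_rtranclp :: "'a trm \<Rightarrow> 'a trm \<Rightarrow> bool" (infix \<open>\<rightarrowtail>*\<close> 50) where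
  "t \<rightarrowtail>* t' \<equiv> (inherits \<Delta>)\<^sup>*\<^sup>* t t'"

definition rank :: "'a \<Rightarrow> nat" where
  "rank \<gamma> = the (classes \<Delta> \<gamma>)"

definition generic :: "'a \<Rightarrow> 'a trm" where
  "generic \<gamma> = App \<gamma> (map Par [0..<rank \<gamma>])"

lemma dom_classes [simp]: "dom (classes \<Delta>) = dom \<Delta>"
  by (auto simp: classes_def)

lemma finite_dom: "finite (dom \<Delta>)"
  using conforms by (simp add: conforms_XM_def well_formed_def class_table_def ranked_alphabet_def)

lemma classes_rank: "\<gamma> \<in> dom \<Delta> \<Longrightarrow> classes \<Delta> \<gamma> = Some (rank \<gamma>)"
  by (auto simp: rank_def classes_def)

lemma classes_SomeD: "classes \<Delta> \<gamma> = Some k \<Longrightarrow> \<gamma> \<in> dom \<Delta> \<and> k = rank \<gamma>"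
  by (auto simp: rank_def classes_def)

lemma generic_in_terms: "\<gamma> \<in> dom \<Delta> \<Longrightarrow> generic \<gamma> \<in> terms (classes \<Delta>) (rank \<gamma>)"
  by (auto simp: generic_def classes_rank)

lemma var_cases:
  assumes "\<gamma> \<in> dom \<Delta>" "i < rank \<gamma>"
  shows "var \<Delta> \<gamma> i = Covariant \<or> var \<Delta> \<gamma> i = Invariant"
proof -
  from assms obtain d where d: "\<Delta> \<gamma> = Some d" "i < length (variances d)"
    by (auto simp: rank_def classes_def)
  then have "variances d ! i \<noteq> Contravariant"
    using conforms by (metis conforms_XM_def nth_mem)
  with d show ?thesis by (cases "variances d ! i") (auto simp: var_def)
qed

lemma supertypeD:
  assumes "\<Delta> \<gamma> = Some d" "\<tau> \<in> set (supertypes d)"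
  shows "\<tau> \<in> terms (classes \<Delta>) (rank \<gamma>)" "\<exists>\<delta> us. \<tau> = App \<delta> us"
proof -
  have "\<tau> \<in> terms (classes \<Delta>) (length (variances d))" "\<forall>i. \<tau> \<noteq> Par i"
    using assms conforms by (auto simp: conforms_XM_def well_formed_def class_table_def)
  then show "\<tau> \<in> terms (classes \<Delta>) (rank \<gamma>)" "\<exists>\<delta> us. \<tau> = App \<delta> us"
    using assms by (auto simp: rank_def classes_def) (metis trm.exhaust)
qed

section \<open>Inheritance and substitution\<close>

lemma inheritsE:
  assumes "inherits \<Delta> t t'"
  obtains \<gamma> d \<tau> ts n where "t = App \<gamma> ts" "t' = subst ts \<tau>" "\<Delta> \<gamma> = Some d"
    "\<tau> \<in> set (supertypes d)" "\<tau> \<in> terms (classes \<Delta>) (length ts)" "t \<in> terms (classes \<Delta>) n"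
  using assms
proof cases
  case (1 \<gamma> d \<tau> ts)
  then obtain n where n: "App \<gamma> ts \<in> terms (classes \<Delta>) n" by blast
  then have "length ts = rank \<gamma>" by (auto dest: classes_SomeD)
  with 1 n show ?thesis
    using supertypeD(1) that by metis
qed

lemma inherits_in_terms:
  assumes "inherits \<Delta> t t'" "t \<in> terms (classes \<Delta>) n"
  shows "t' \<in> terms (classes \<Delta>) n"
  using assms by (auto elim!: inheritsE intro: subst_in_terms)

lemma inherits_rtranclp_in_terms:
  "t \<rightarrowtail>* t' \<Longrightarrow> t \<in> terms (classes \<Delta>) n \<Longrightarrow> t' \<in> terms (classes \<Delta>) n"
  by (induction rule: rtranclp_induct) (auto intro: inherits_in_terms)

lemma inherits_subst:
  assumes "inherits \<Delta> t t'" "t \<in> terms (classes \<Delta>) (length ts)"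
    "\<forall>t \<in> set ts. t \<in> terms (classes \<Delta>) n"
  shows "inherits \<Delta> (subst ts t) (subst ts t')"
  using assms(1)
proof (rule inheritsE)
  fix \<gamma> d \<tau> us
  assume *: "t = App \<gamma> us" "t' = subst us \<tau>" "\<Delta> \<gamma> = Some d" "\<tau> \<in> set (supertypes d)"
    "\<tau> \<in> terms (classes \<Delta>) (length us)"
  have "subst ts t \<in> terms (classes \<Delta>) n"
    using assms(2,3) by (rule subst_in_terms)
  with * have "inherits \<Delta> (App \<gamma> (map (subst ts) us)) (subst (map (subst ts) us) \<tau>)"
    by (intro inherits.intros[of _ _ d]) auto
  with * show ?thesis by (simp add: subst_subst)
qed

text \<open>Inheritance commutes with substitution, so the chains from
  \<open>generic \<gamma>\<close> are templates for the chains from every type with root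
  \<open>\<gamma>\<close>. This lets the productions of one variable serve all arguments.\<close>

lemma inherits_rtranclp_generic:
  assumes ts: "App \<gamma> ts \<in> terms (classes \<Delta>) n"
  shows "App \<gamma> ts \<rightarrowtail>* u \<longleftrightarrow> (\<exists>\<delta> us. generic \<gamma> \<rightarrowtail>* App \<delta> us \<and> u = subst ts (App \<delta> us))"
    (is "_ \<longleftrightarrow> ?R u")
proof
  from ts have len: "rank \<gamma> = length ts" and \<gamma>: "\<gamma> \<in> dom \<Delta>"
    by (auto dest: classes_SomeD)
  assume "App \<gamma> ts \<rightarrowtail>* u"
  then show "?R u"
  proof (induction rule: rtranclp_induct)
    case base
    have "generic \<gamma> \<rightarrowtail>* App \<gamma> (map Par [0..<rank \<gamma>])" by (simp add: generic_def)
    moreover have "App \<gamma> ts = subst ts (App \<gamma> (map Par [0..<rank \<gamma>]))"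
      using map_subst_Par_upt[of ts] by (simp add: len)
    ultimately show ?case by blast
  next
    case (step u u')
    then obtain \<delta> us where g: "generic \<gamma> \<rightarrowtail>* App \<delta> us" and u: "u = subst ts (App \<delta> us)" by blast
    have us: "App \<delta> us \<in> terms (classes \<Delta>) (rank \<gamma>)"
      using g generic_in_terms[OF \<gamma>] by (rule inherits_rtranclp_in_terms)
    from step(2) u obtain d \<tau> where d: "\<Delta> \<delta> = Some d" "\<tau> \<in> set (supertypes d)"
      and \<tau>: "\<tau> \<in> terms (classes \<Delta>) (length us)" and u': "u' = subst (map (subst ts) us) \<tau>"
      by (auto elim!: inheritsE)
    from d us have "inherits \<Delta> (App \<delta> us) (subst us \<tau>)"
      by (blast intro: inherits.intros)
    with g have "generic \<gamma> \<rightarrowtail>* subst us \<tau>" by simp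
    moreover have "u' = subst ts (subst us \<tau>)"
      using u' subst_subst[OF \<tau>] by simp
    \<comment> \<open>Declared supertypes are never parameters, so the root is a class already
      before \<open>ts\<close> is substituted.\<close>
    moreover obtain \<delta>' ws where "subst us \<tau> = App \<delta>' ws"
      using supertypeD(2)[OF d] by auto
    ultimately show ?case by metis
  qed
next
  from ts have len: "rank \<gamma> = length ts" and \<gamma>: "\<gamma> \<in> dom \<Delta>"
    by (auto dest: classes_SomeD)
  have "subst ts (generic \<gamma>) \<rightarrowtail>* subst ts u'" if "generic \<gamma> \<rightarrowtail>* u'" for u'
    using that
  proof (induction rule: rtranclp_induct)
    case (step v w)
    have "v \<in> terms (classes \<Delta>) (length ts)"
      using step(1) generic_in_terms[OF \<gamma>] len by (auto intro: inherits_rtranclp_in_terms)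
    with step(2) ts have "inherits \<Delta> (subst ts v) (subst ts w)"
      by (intro inherits_subst) auto
    with step.IH show ?case by (rule rtranclp.rtrancl_into_rtrancl)
  qed simp
  moreover have "subst ts (generic \<gamma>) = App \<gamma> ts"
    using map_subst_Par_upt[of ts] by (simp add: len generic_def)
  moreover assume "?R u"
  ultimately show "App \<gamma> ts \<rightarrowtail>* u" by metis
qed

text \<open>Inheritance between roots only. Edges point from supertype to class, so that
  well-founded induction proceeds from the supertypes.\<close>

definition class_graph :: "('a \<times> 'a) set" where
  "class_graph = {(\<delta>, \<gamma>). \<exists>d us. \<Delta> \<gamma> = Some d \<and> App \<delta> us \<in> set (supertypes d)}"

text \<open>Acyclicity is assumed for types, not for class names; lifting a path of names to a chain
  of types transfers it.\<close>

lemma class_graph_trancl_inherits: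
  assumes "(\<delta>, \<gamma>) \<in> class_graph\<^sup>+" "App \<gamma> ts \<in> terms (classes \<Delta>) n"
  shows "\<exists>us. (inherits \<Delta>)\<^sup>+\<^sup>+ (App \<gamma> ts) (App \<delta> us) \<and> App \<delta> us \<in> terms (classes \<Delta>) n"
proof -
  have edge: "\<exists>us. inherits \<Delta> (App \<gamma> ts) (App \<delta> us) \<and> App \<delta> us \<in> terms (classes \<Delta>) n"
    if "(\<delta>, \<gamma>) \<in> class_graph" "App \<gamma> ts \<in> terms (classes \<Delta>) n" for \<delta> \<gamma> ts
  proof -
    from that(1) obtain d us where "\<Delta> \<gamma> = Some d" "App \<delta> us \<in> set (supertypes d)"
      by (auto simp: class_graph_def)
    with that(2) have "inherits \<Delta> (App \<gamma> ts) (subst ts (App \<delta> us))"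
      by (blast intro: inherits.intros)
    with that(2) show ?thesis
      using inherits_in_terms by (metis subst.simps(2))
  qed
  show ?thesis
    using assms
  proof (induction arbitrary: ts rule: trancl_induct)
    case (base \<gamma>)
    then show ?case using edge by blast
  next
    case (step \<gamma> \<gamma>')
    from edge[OF step(2) step.prems] obtain us where
      us: "inherits \<Delta> (App \<gamma>' ts) (App \<gamma> us)" "App \<gamma> us \<in> terms (classes \<Delta>) n" by blast
    from step.IH[OF us(2)] obtain ws where
      "(inherits \<Delta>)\<^sup>+\<^sup>+ (App \<gamma> us) (App \<delta> ws)" "App \<delta> ws \<in> terms (classes \<Delta>) n" by blast
    with us(1) show ?case by (meson tranclp_into_tranclp2)
  qed
qed

text \<open>The graph is finite, and a cycle through \<open>\<gamma>\<close> would lift to a chain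
  from \<open>generic \<gamma>\<close> to a type with the same root.\<close>

lemma wf_class_graph: "wf class_graph"
proof (rule finite_acyclic_wf)
  have "class_graph \<subseteq> dom \<Delta> \<times> dom \<Delta>"
  proof (rule subrelI)
    fix \<delta> \<gamma> assume "(\<delta>, \<gamma>) \<in> class_graph"
    then obtain d us where d: "\<Delta> \<gamma> = Some d" "App \<delta> us \<in> set (supertypes d)"
      by (auto simp: class_graph_def)
    from supertypeD(1)[OF d] d show "(\<delta>, \<gamma>) \<in> dom \<Delta> \<times> dom \<Delta>"
      by (auto dest: classes_SomeD)
  qed
  then show "finite class_graph"
    using finite_dom finite_subset by blast
  show "acyclic class_graph"
    unfolding acyclic_def
  proof (intro allI notI)
    fix \<gamma> assume c: "(\<gamma>, \<gamma>) \<in> class_graph\<^sup>+"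
    then have "\<gamma> \<in> dom \<Delta>"
      using \<open>class_graph \<subseteq> dom \<Delta> \<times> dom \<Delta>\<close> by (metis mem_Sigma_iff subsetD trancl_subset_Sigma)
    then obtain us where "(inherits \<Delta>)\<^sup>+\<^sup>+ (generic \<gamma>) (App \<gamma> us)"
      using class_graph_trancl_inherits[OF c] generic_in_terms unfolding generic_def by blast
    then show False
      using conforms
      by (auto simp: conforms_XM_def well_formed_def acyclic_inheritance_def generic_def)
  qed
qed

text \<open>There are finitely many direct supertypes, with smaller roots in
  \<open>class_graph\<close>. Arguments may grow along the way, hence the generalization over
  \<open>ts\<close>.\<close>

lemma finite_inherits_rtranclp: "finite {u. App \<gamma> ts \<rightarrowtail>* u}"
proof (induction \<gamma> arbitrary: ts rule: wf_induct_rule[OF wf_class_graph])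
  case (1 \<gamma>)
  have "{u. inherits \<Delta> (App \<gamma> ts) u} \<subseteq> subst ts ` set (supertypes (the (\<Delta> \<gamma>)))"
    by (auto elim!: inherits.cases)
  then have "finite {u. inherits \<Delta> (App \<gamma> ts) u}"
    using finite_subset by blast
  moreover have "finite {w. u \<rightarrowtail>* w}" if u: "inherits \<Delta> (App \<gamma> ts) u" for u
  proof -
    from u obtain d \<tau> where d: "\<Delta> \<gamma> = Some d" "\<tau> \<in> set (supertypes d)" "u = subst ts \<tau>"
      by (auto elim: inherits.cases)
    moreover from d obtain \<delta> us where "\<tau> = App \<delta> us" using supertypeD(2) by blast
    moreover from this d have "(\<delta>, \<gamma>) \<in> class_graph" by (auto simp: class_graph_def)
    ultimately show ?thesis using 1 by simp
  qed
  ultimately have "finite (insert (App \<gamma> ts) (\<Union>u \<in> {u. inherits \<Delta> (App \<gamma> ts) u}. {w. u \<rightarrowtail>* w}))"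
    by simp
  moreover have "{u. App \<gamma> ts \<rightarrowtail>* u} \<subseteq>
      insert (App \<gamma> ts) (\<Union>u \<in> {u. inherits \<Delta> (App \<gamma> ts) u}. {w. u \<rightarrowtail>* w})"
    by (blast elim: converse_rtranclpE)
  ultimately show ?case
    by (rule finite_subset[rotated])
qed

text \<open>A subtyping derivation is a run of \<open>Super\<close> steps closed by one
  \<open>Var\<close> step at the root. Without contravariance, a position that is not covariant is
  invariant.\<close>

lemma subtype_iff:
  assumes "t \<in> ground_terms (classes \<Delta>)" "App \<gamma> us' \<in> ground_terms (classes \<Delta>)"
  shows "subtype \<Delta> t (App \<gamma> us') \<longleftrightarrow>
    (\<exists>us. t \<rightarrowtail>* App \<gamma> us \<and> length us = length us' \<and>
      (\<forall>i < length us. if var \<Delta> \<gamma> i = Covariant then subtype \<Delta> (us ! i) (us' ! i) else us ! i = us' ! i))"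
    (is "_ \<longleftrightarrow> ?R t")
proof
  assume "subtype \<Delta> t (App \<gamma> us')"
  then show "?R t"
  proof (induction t "App \<gamma> us'" rule: subtype.induct)
    case (Var ts)
    then have "length ts = rank \<gamma>" "\<gamma> \<in> dom \<Delta>" "length ts = length us'"
      by (auto dest: classes_SomeD)
    moreover from this have "var \<Delta> \<gamma> i = Invariant" if "i < length ts" "var \<Delta> \<gamma> i \<noteq> Covariant" for i
      using that var_cases by metis
    ultimately show ?case
      using Var by (intro exI[of _ ts]) simp
  next
    case (Super t t')
    then show ?case by (meson converse_rtranclp_into_rtranclp)
  qed
next
  assume "?R t"
  then obtain us where chain: "t \<rightarrowtail>* App \<gamma> us" and us: "length us = length us'"
    "\<forall>i < length us. if var \<Delta> \<gamma> i = Covariant then subtype \<Delta> (us ! i) (us' ! i) else us ! i = us' ! i"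
    by blast
  from chain assms(1) show "subtype \<Delta> t (App \<gamma> us')"
  proof (induction rule: converse_rtranclp_induct)
    case base
    have var: "var \<Delta> \<gamma> i = Covariant \<or> var \<Delta> \<gamma> i = Invariant" if "i < length us" for i
      using that assms(2) us(1) var_cases classes_SomeD by simp
    show ?case
    proof (intro subtype.Var allI impI)
      fix i assume "i < length us"
      with us(2) var[of i] show "(var \<Delta> \<gamma> i = Covariant \<longrightarrow> subtype \<Delta> (us ! i) (us' ! i)) \<and>
          (var \<Delta> \<gamma> i = Invariant \<longrightarrow> us ! i = us' ! i) \<and>
          (var \<Delta> \<gamma> i = Contravariant \<longrightarrow> subtype \<Delta> (us' ! i) (us ! i))"
        by auto
    qed (use base assms(2) in auto)
  next
    case (step t t')
    from step.prems step.hyps(1) step.IH[OF inherits_in_terms[OF step.hyps(1) step.prems]]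
    show ?case by (rule subtype.Super)
  qed
qed

end

section \<open>Class tables as grammars\<close>

datatype 'a fresh_variable = Start | Up 'a | Exact 'a

text \<open>Variables and classes share the type \<open>'a\<close>; \<open>name\<close> embeds the
  new variables there, apart from each other and from all classes.\<close>

locale table_grammar = noncontravariant_table \<Delta> for \<Delta> :: "'a class_table" +
  fixes t_bot :: "'a trm" and \<Sigma> :: "'a alphabet" and name :: "'a fresh_variable \<Rightarrow> 'a"
  assumes t_bot: "t_bot \<in> ground_terms (classes \<Delta>)"
    and \<Sigma>_le: "\<Sigma> \<subseteq>\<^sub>m classes \<Delta>"
    and inj_name: "inj_on name (insert Start (Up ` dom \<Delta> \<union> Exact ` dom \<Delta>))"
    and name_fresh: "name ` insert Start (Up ` dom \<Delta> \<union> Exact ` dom \<Delta>) \<inter> dom \<Delta> = {}"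
begin

abbreviation fresh_variables :: "'a fresh_variable set" where
  "fresh_variables \<equiv> insert Start (Up ` dom \<Delta> \<union> Exact ` dom \<Delta>)"

primrec variable_rank :: "'a fresh_variable \<Rightarrow> nat" where
  "variable_rank Start = 0"
| "variable_rank (Up \<gamma>) = rank \<gamma> + rank \<gamma>"
| "variable_rank (Exact \<gamma>) = rank \<gamma>"

text \<open>Classes outside \<open>\<Sigma>\<close> are not symbols of the grammar, so each class is
  replaced by a variable. \<open>Exact \<gamma>\<close> will have a production only for
  \<open>\<gamma>\<close> in \<open>\<Sigma>\<close>; a type using other classes generates
  nothing.\<close>

primrec exact :: "'a trm \<Rightarrow> 'a trm" where
  "exact (Par i) = Par i"
| "exact (App \<gamma> ts) = App (name (Exact \<gamma>)) (map exact ts)"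

text \<open>Below \<open>k\<close> parameters, \<open>Par i\<close> with \<open>i < k\<close> stands for the exact copy of an argument and
  \<open>Par (k + i)\<close> for the copy that generates its supertypes.\<close>

primrec up :: "nat \<Rightarrow> 'a trm \<Rightarrow> 'a trm" where
  "up k (Par i) = Par (k + i)"
| "up k (App \<gamma> ts) = App (name (Up \<gamma>)) (map exact ts @ map (up k) ts)"

text \<open>The right-hand side for a chain that stops at \<open>App \<gamma> us\<close>: the root
  is fixed as a terminal, and only covariant arguments may still move to supertypes.\<close>

definition copy :: "nat \<Rightarrow> 'a \<Rightarrow> 'a trm list \<Rightarrow> 'a trm" where
  "copy k \<gamma> us = App \<gamma> (map (\<lambda>i. if var \<Delta> \<gamma> i = Covariant then up k (us ! i) else exact (us ! i))
     [0..<length us])"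

text \<open>A production for a single inheritance step would have a variable at its root, against
  the normal form. Hence each production performs a whole chain, and \<open>Start\<close> gets the
  chains from \<open>t_bot\<close> directly rather than the right-hand side
  \<open>up 0 t_bot\<close>.\<close>

definition grammar :: "'a grammar" where
  "grammar = \<lparr>terminals = \<Sigma>,
     variables = (\<lambda>x. if x \<in> name ` fresh_variables
       then Some (variable_rank (inv_into fresh_variables name x)) else None),
     start = name Start,
     productions =
       {(name Start, copy 0 \<gamma> us) | \<gamma> us. t_bot \<rightarrowtail>* App \<gamma> us \<and> \<gamma> \<in> dom \<Sigma>} \<union>
       {(name (Up \<delta>), copy (rank \<delta>) \<gamma> us) | \<delta> \<gamma> us.
          \<delta> \<in> dom \<Delta> \<and> generic \<delta> \<rightarrowtail>* App \<gamma> us \<and> \<gamma> \<in> dom \<Sigma>} \<union>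
       {(name (Exact \<gamma>), generic \<gamma>) | \<gamma>. \<gamma> \<in> dom \<Sigma>}\<rparr>"

section \<open>Symbols and productions of the grammar\<close>

lemma terminals_grammar [simp]: "terminals grammar = \<Sigma>"
  and start_grammar [simp]: "start grammar = name Start"
  by (simp_all add: grammar_def)

lemma dom_\<Sigma>: "\<gamma> \<in> dom \<Sigma> \<Longrightarrow> \<gamma> \<in> dom \<Delta>"
  using \<Sigma>_le map_le_implies_dom_le dom_classes by blast

lemma \<Sigma>_rank: "\<gamma> \<in> dom \<Sigma> \<Longrightarrow> \<Sigma> \<gamma> = Some (rank \<gamma>)"
  using \<Sigma>_le dom_\<Sigma> classes_rank by (metis map_le_def)

lemma dom_variables_grammar: "dom (variables grammar) = name ` fresh_variables"
  unfolding grammar_def grammar.simps dom_def by (simp only: if_split_eq1) blast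

lemma variables_grammar_disjoint: "dom (variables grammar) \<inter> dom \<Delta> = {}"
  by (simp only: dom_variables_grammar name_fresh)

lemma variables_grammar:
  "n \<in> fresh_variables \<Longrightarrow> variables grammar (name n) = Some (variable_rank n)"
  using inj_name by (simp only: grammar_def grammar.simps imageI inv_into_f_f if_True)

lemma symbols_grammar:
  "n \<in> fresh_variables \<Longrightarrow> symbols grammar (name n) = Some (variable_rank n)"
  using variables_grammar by (simp add: map_add_def)

lemma symbols_grammar_\<Sigma>:
  assumes "\<gamma> \<in> dom \<Sigma>"
  shows "symbols grammar \<gamma> = Some (rank \<gamma>)"
proof -
  have "variables grammar \<gamma> = None"
    using variables_grammar_disjoint dom_\<Sigma>[OF assms] by (meson disjoint_iff domIff)
  with \<Sigma>_rank[OF assms] show ?thesis by (simp add: map_add_def)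
qed

lemma name_eq_iff:
  "n \<in> fresh_variables \<Longrightarrow> n' \<in> fresh_variables \<Longrightarrow> name n = name n' \<longleftrightarrow> n = n'"
  using inj_name by (rule inj_on_eq_iff)

lemma name_distinct:
  "\<gamma> \<in> dom \<Delta> \<Longrightarrow> name (Up \<gamma>) \<noteq> name Start"
  "\<gamma> \<in> dom \<Delta> \<Longrightarrow> name (Exact \<gamma>) \<noteq> name Start"
  "\<gamma> \<in> dom \<Delta> \<Longrightarrow> \<delta> \<in> dom \<Delta> \<Longrightarrow> name (Up \<gamma>) \<noteq> name (Exact \<delta>)"
  "\<gamma> \<in> dom \<Delta> \<Longrightarrow> \<delta> \<in> dom \<Delta> \<Longrightarrow> name (Up \<gamma>) = name (Up \<delta>) \<Longrightarrow> \<gamma> = \<delta>"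
  "\<gamma> \<in> dom \<Delta> \<Longrightarrow> \<delta> \<in> dom \<Delta> \<Longrightarrow> name (Exact \<gamma>) = name (Exact \<delta>) \<Longrightarrow> \<gamma> = \<delta>"
  using name_eq_iff[of "Up \<gamma>" Start] name_eq_iff[of "Exact \<gamma>" Start] name_eq_iff[of "Up \<gamma>" "Exact \<delta>"]
    name_eq_iff[of "Up \<gamma>" "Up \<delta>"] name_eq_iff[of "Exact \<gamma>" "Exact \<delta>"]
  by simp_all

lemma name_notin_\<Sigma>: "n \<in> fresh_variables \<Longrightarrow> name n \<notin> dom \<Sigma>"
  using name_fresh dom_\<Sigma> by (metis disjoint_iff imageI)

lemma productions_Start:
  "(name Start, \<tau>) \<in> productions grammar \<longleftrightarrow>
     (\<exists>\<gamma> us. \<tau> = copy 0 \<gamma> us \<and> t_bot \<rightarrowtail>* App \<gamma> us \<and> \<gamma> \<in> dom \<Sigma>)"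
  unfolding grammar_def grammar.simps Un_iff mem_Collect_eq prod.inject
  using name_distinct(1,2)[symmetric] dom_\<Sigma> by blast

lemma productions_Up:
  "\<delta> \<in> dom \<Delta> \<Longrightarrow> (name (Up \<delta>), \<tau>) \<in> productions grammar \<longleftrightarrow>
     (\<exists>\<gamma> us. \<tau> = copy (rank \<delta>) \<gamma> us \<and> generic \<delta> \<rightarrowtail>* App \<gamma> us \<and> \<gamma> \<in> dom \<Sigma>)"
  unfolding grammar_def grammar.simps Un_iff mem_Collect_eq prod.inject
  using name_distinct(1,3,4) dom_\<Sigma> by blast

lemma productions_Exact:
  "\<delta> \<in> dom \<Delta> \<Longrightarrow> (name (Exact \<delta>), \<tau>) \<in> productions grammar \<longleftrightarrow> \<tau> = generic \<delta> \<and> \<delta> \<in> dom \<Sigma>"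
  unfolding grammar_def grammar.simps Un_iff mem_Collect_eq prod.inject
  using name_distinct(2,5) name_distinct(3)[symmetric] dom_\<Sigma> by blast

section \<open>The grammar is context-free and in normal form\<close>

lemma exact_in_terms:
  assumes "t \<in> terms (classes \<Delta>) k" "k \<le> k'"
  shows "exact t \<in> terms (symbols grammar) k'"
  using assms
proof (induction rule: terms.induct)
  case (App f ts)
  from App(1) have "f \<in> dom \<Delta>" "length ts = rank f" by (auto dest: classes_SomeD)
  with App show ?case using symbols_grammar[of "Exact f"] by auto
qed simp

lemma up_in_terms:
  assumes "t \<in> terms (classes \<Delta>) k"
  shows "up k t \<in> terms (symbols grammar) (k + k)"
  using assms
proof (induction rule: terms.induct)
  case (App f ts)
  from App(1) have "f \<in> dom \<Delta>" "length ts = rank f" by (auto dest: classes_SomeD)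
  with App show ?case
    using symbols_grammar[of "Up f"] exact_in_terms[of _ k "k + k"] by auto
qed simp

lemma copy_in_terms:
  assumes "App \<gamma> us \<in> terms (classes \<Delta>) k" "\<gamma> \<in> dom \<Sigma>"
  shows "copy k \<gamma> us \<in> terms (symbols grammar) (k + k)"
  using assms symbols_grammar_\<Sigma>[OF assms(2)] up_in_terms[of _ k] exact_in_terms[of _ k "k + k"]
  by (auto simp: copy_def dest: classes_SomeD)

lemma finite_productions: "finite (productions grammar)"
proof -
  \<comment> \<open>\<open>f k\<close> extends \<open>copy k\<close> to all terms, with a dummy
    value at parameters, so that the productions lie in images of the finite sets of inherited
    types.\<close>
  define f where "f k u = (case u of App \<gamma> us \<Rightarrow> copy k \<gamma> us | Par i \<Rightarrow> Par i)" for k u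
  define P where "P = ((\<lambda>u. (name Start, f 0 u)) ` {u. t_bot \<rightarrowtail>* u} \<union>
      (\<Union>\<delta> \<in> dom \<Delta>. (\<lambda>u. (name (Up \<delta>), f (rank \<delta>) u)) ` {u. generic \<delta> \<rightarrowtail>* u}) \<union>
      (\<lambda>\<gamma>. (name (Exact \<gamma>), generic \<gamma>)) ` dom \<Delta>)"
  have "finite {u. t_bot \<rightarrowtail>* u}"
    using t_bot finite_inherits_rtranclp by (auto elim!: ground_termsE)
  then have "finite P"
    unfolding P_def using finite_dom finite_inherits_rtranclp by (auto simp: generic_def)
  moreover have "productions grammar \<subseteq> P"
  proof -
    have "(name Start, copy 0 \<gamma> us) \<in> P" if "t_bot \<rightarrowtail>* App \<gamma> us" for \<gamma> us
      unfolding P_def using that by (intro UnI1 image_eqI[where x = "App \<gamma> us"]) (auto simp: f_def)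
    moreover have "(name (Up \<delta>), copy (rank \<delta>) \<gamma> us) \<in> P"
      if "\<delta> \<in> dom \<Delta>" "generic \<delta> \<rightarrowtail>* App \<gamma> us" for \<delta> \<gamma> us
      unfolding P_def using that
      by (intro UnI1[OF UnI2] UN_I[of \<delta>] image_eqI[where x = "App \<gamma> us"]) (auto simp: f_def)
    moreover have "(name (Exact \<gamma>), generic \<gamma>) \<in> P" if "\<gamma> \<in> dom \<Sigma>" for \<gamma>
      unfolding P_def using dom_\<Sigma>[OF that] by (intro UnI2 image_eqI) auto
    ultimately show ?thesis
      unfolding grammar_def grammar.simps by blast
  qed
  ultimately show ?thesis by (rule finite_subset[rotated])
qed

lemma cf_grammar: "context_free_tree_grammar grammar"
proof -
  have "finite (dom \<Sigma>)"
    using finite_dom dom_\<Sigma> by (metis finite_subset subsetI)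
  moreover have "finite (dom (variables grammar))"
    using finite_dom by (simp add: dom_variables_grammar)
  moreover have "dom \<Sigma> \<inter> dom (variables grammar) = {}"
    using variables_grammar_disjoint dom_\<Sigma> by (metis disjoint_iff)
  moreover have "\<exists>k. variables grammar v = Some k \<and> \<tau> \<in> terms (symbols grammar) k"
    if "(v, \<tau>) \<in> productions grammar" for v \<tau>
  proof -
    from that consider
      (Start) \<gamma> us where "v = name Start" "\<tau> = copy 0 \<gamma> us" "t_bot \<rightarrowtail>* App \<gamma> us" "\<gamma> \<in> dom \<Sigma>"
      | (Up) \<delta> \<gamma> us where "v = name (Up \<delta>)" "\<tau> = copy (rank \<delta>) \<gamma> us" "\<delta> \<in> dom \<Delta>"
          "generic \<delta> \<rightarrowtail>* App \<gamma> us" "\<gamma> \<in> dom \<Sigma>"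
      | (Exact) \<gamma> where "v = name (Exact \<gamma>)" "\<tau> = generic \<gamma>" "\<gamma> \<in> dom \<Sigma>"
      unfolding grammar_def grammar.simps by blast
    then show ?thesis
    proof cases
      case Start
      from inherits_rtranclp_in_terms[OF Start(3) t_bot] Start(4)
      have "copy 0 \<gamma> us \<in> terms (symbols grammar) (0 + 0)" by (rule copy_in_terms)
      with Start show ?thesis using variables_grammar[of Start] by auto
    next
      case Up
      from inherits_rtranclp_in_terms[OF Up(4) generic_in_terms[OF Up(3)]] Up(5)
      have "copy (rank \<delta>) \<gamma> us \<in> terms (symbols grammar) (rank \<delta> + rank \<delta>)" by (rule copy_in_terms)
      with Up show ?thesis using variables_grammar[of "Up \<delta>"] by auto
    next
      case Exact
      then show ?thesis
        using variables_grammar[of "Exact \<gamma>"] dom_\<Sigma> symbols_grammar_\<Sigma> by (auto simp: generic_def)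
    qed
  qed
  ultimately show ?thesis
    using finite_productions variables_grammar[of Start]
    by (auto simp: context_free_tree_grammar_def ranked_alphabet_def)
qed

lemma gnf_grammar: "greibach_normal_form grammar"
  unfolding greibach_normal_form_def terminals_grammar
  by (auto simp: grammar_def copy_def generic_def)

section \<open>The grammar generates the supertypes of \<open>t_bot\<close>\<close>

sublocale cf_grammar grammar
  by unfold_locales (rule cf_grammar)

text \<open>\<open>exact t\<close> refers only to the first \<open>length ts\<close> parameters, so
  \<open>us\<close> is arbitrary.\<close>

lemma subst_exact:
  assumes "t \<in> terms (classes \<Delta>) (length ts)"
  shows "subst (map exact ts @ us) (exact t) = exact (subst ts t)"
  using assms by (induction rule: terms.induct) (auto simp: nth_append)

text \<open>Passing each argument in both versions is what makes the translation commute with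
  substitution. It is applied to ground arguments, translated by \<open>up 0\<close>.\<close>

lemma subst_up:
  assumes "t \<in> terms (classes \<Delta>) (length ts)"
  shows "subst (map exact ts @ map (up 0) ts) (up (length ts) t) = up 0 (subst ts t)"
  using assms by (induction rule: terms.induct) (auto simp: nth_append subst_exact)

lemma subst_copy:
  assumes "App \<gamma> us \<in> terms (classes \<Delta>) (length ts)"
  shows "subst (map exact ts @ map (up 0) ts) (copy (length ts) \<gamma> us) = copy 0 \<gamma> (map (subst ts) us)"
  using assms by (auto simp: copy_def subst_exact subst_up)

lemma generates_copy_iff:
  assumes "\<gamma> \<in> dom \<Sigma>"
  shows "generates grammar (copy 0 \<gamma> us) t' \<longleftrightarrow>
    (\<exists>us'. t' = App \<gamma> us' \<and> length us = length us' \<and>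
      (\<forall>i < length us. if var \<Delta> \<gamma> i = Covariant then generates grammar (up 0 (us ! i)) (us' ! i)
        else generates grammar (exact (us ! i)) (us' ! i)))"
  using assms unfolding copy_def
  by (simp add: generates_terminal_iff) (auto simp: list_all2_conv_all_nth)

text \<open>Expanding the root variable performs a full chain from the generic type;
  \<open>subst_copy\<close> and \<open>inherits_rtranclp_generic\<close> turn it into a chain from
  \<open>t\<close>.\<close>

lemma generates_up_iff:
  assumes "t \<in> ground_terms (classes \<Delta>)"
  shows "generates grammar (up 0 t) t' \<longleftrightarrow>
    (\<exists>\<gamma> us. t \<rightarrowtail>* App \<gamma> us \<and> \<gamma> \<in> dom \<Sigma> \<and> generates grammar (copy 0 \<gamma> us) t')"
proof -
  from assms obtain \<delta> ts where t: "t = App \<delta> ts" and ts: "classes \<Delta> \<delta> = Some (length ts)"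
    by (rule ground_termsE)
  then have \<delta>: "\<delta> \<in> dom \<Delta>" and len: "rank \<delta> = length ts" by (auto dest: classes_SomeD)
  have "generates grammar (up 0 t) t' \<longleftrightarrow> (\<exists>\<gamma> us. generic \<delta> \<rightarrowtail>* App \<gamma> us \<and> \<gamma> \<in> dom \<Sigma> \<and>
      generates grammar (subst (map exact ts @ map (up 0) ts) (copy (rank \<delta>) \<gamma> us)) t')"
    using name_notin_\<Sigma>[of "Up \<delta>"] \<delta>
    by (auto simp: t generates_variable_iff productions_Up)
  also have "\<dots> \<longleftrightarrow> (\<exists>\<gamma> us. generic \<delta> \<rightarrowtail>* App \<gamma> us \<and> \<gamma> \<in> dom \<Sigma> \<and>
      generates grammar (copy 0 \<gamma> (map (subst ts) us)) t')"
  proof -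
    have "subst (map exact ts @ map (up 0) ts) (copy (rank \<delta>) \<gamma> us) = copy 0 \<gamma> (map (subst ts) us)"
      if "generic \<delta> \<rightarrowtail>* App \<gamma> us" for \<gamma> us
      using inherits_rtranclp_in_terms[OF that generic_in_terms[OF \<delta>]] subst_copy
      unfolding len by blast
    then show ?thesis by metis
  qed
  also have "\<dots> \<longleftrightarrow>
      (\<exists>\<gamma> us. t \<rightarrowtail>* App \<gamma> us \<and> \<gamma> \<in> dom \<Sigma> \<and> generates grammar (copy 0 \<gamma> us) t')"
    using inherits_rtranclp_generic[of \<delta> ts 0] assms unfolding t by auto
  finally show ?thesis .
qed

lemma generates_Start_iff:
  "generates grammar (App (name Start) []) t' \<longleftrightarrow> generates grammar (up 0 t_bot) t'"
  using name_notin_\<Sigma>[of Start]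
  by (auto simp: generates_up_iff[OF t_bot] generates_variable_iff productions_Start)

lemma generates_exact_iff:
  assumes "t' \<in> ground_terms \<Sigma>" "t \<in> ground_terms (classes \<Delta>)"
  shows "generates grammar (exact t) t' \<longleftrightarrow> t = t'"
  using assms
proof (induction arbitrary: t rule: terms.induct)
  case (App f us)
  from App.prems obtain \<gamma> ts where t: "t = App \<gamma> ts" and "classes \<Delta> \<gamma> = Some (length ts)"
    and ts: "\<forall>t \<in> set ts. t \<in> ground_terms (classes \<Delta>)"
    by (rule ground_termsE)
  then have \<gamma>: "\<gamma> \<in> dom \<Delta>" and len: "rank \<gamma> = length ts" by (auto dest: classes_SomeD)
  have "subst (map exact ts) (generic \<gamma>) = App \<gamma> (map exact ts)"
    using map_subst_Par_upt[of "map exact ts"] by (simp add: generic_def len)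
  then have "generates grammar (exact t) (App f us) \<longleftrightarrow>
      \<gamma> \<in> dom \<Sigma> \<and> generates grammar (App \<gamma> (map exact ts)) (App f us)"
    using name_notin_\<Sigma>[of "Exact \<gamma>"] \<gamma>
    by (auto simp: t generates_variable_iff productions_Exact)
  also have "\<dots> \<longleftrightarrow> \<gamma> = f \<and> list_all2 (\<lambda>t u. generates grammar (exact t) u) ts us"
  proof -
    have "generates grammar (App \<gamma> (map exact ts)) (App f us) \<longleftrightarrow>
        \<gamma> = f \<and> list_all2 (\<lambda>t u. generates grammar (exact t) u) ts us" if "\<gamma> \<in> dom \<Sigma>"
      using generates_terminal_iff[of \<gamma>] that unfolding terminals_grammar
      by (auto simp: list_all2_map1)
    \<comment> \<open>Since \<open>f\<close> belongs to \<open>\<Sigma>\<close>, the equation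
      \<open>\<gamma> = f\<close> already yields membership of \<open>\<gamma>\<close>.\<close>
    with App.hyps(1) show ?thesis by blast
  qed
  also have "list_all2 (\<lambda>t u. generates grammar (exact t) u) ts us \<longleftrightarrow> list_all2 (=) ts us"
    using App.IH ts by (intro list.rel_cong) auto
  finally show ?case by (auto simp: t list.rel_eq)
qed simp

text \<open>The induction is on \<open>t'\<close>: inheritance may enlarge the type on the left, but
  each comparison of arguments descends in the target. \<open>generates_copy_iff\<close> and
  \<open>subtype_iff\<close> then match position by position.\<close>

lemma generates_up_iff_subtype:
  assumes "t' \<in> ground_terms \<Sigma>" "t \<in> ground_terms (classes \<Delta>)"
  shows "generates grammar (up 0 t) t' \<longleftrightarrow> subtype \<Delta> t t'"
  using assms
proof (induction arbitrary: t rule: terms.induct)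
  case (App f us')
  then have f: "f \<in> dom \<Sigma>" by blast
  have ground: "App f us' \<in> ground_terms (classes \<Delta>)"
    using terms_mono[OF \<Sigma>_le terms.App] App.hyps by blast
  have "(if var \<Delta> f i = Covariant then generates grammar (up 0 (us ! i)) (us' ! i)
        else generates grammar (exact (us ! i)) (us' ! i)) \<longleftrightarrow>
      (if var \<Delta> f i = Covariant then subtype \<Delta> (us ! i) (us' ! i) else us ! i = us' ! i)"
    if "t \<rightarrowtail>* App f us" "length us = length us'" "i < length us" for us i
  proof -
    have "us ! i \<in> ground_terms (classes \<Delta>)"
      using inherits_rtranclp_in_terms[OF that(1) App.prems] that(3) by simp
    with App.IH App.hyps(2) that show ?thesis
      by (simp add: generates_exact_iff)
  qed
  then have "generates grammar (up 0 t) (App f us') \<longleftrightarrow>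
    (\<exists>us. t \<rightarrowtail>* App f us \<and> length us = length us' \<and>
      (\<forall>i < length us. if var \<Delta> f i = Covariant then subtype \<Delta> (us ! i) (us' ! i) else us ! i = us' ! i))"
    unfolding generates_up_iff[OF App.prems]
    using f generates_copy_iff by (smt (verit) trm.inject(2))
  then show ?case
    using subtype_iff[OF App.prems ground] by simp
qed simp

lemma grammar_forest_grammar: "grammar_forest grammar = supertype_forest \<Delta> t_bot \<Sigma>"
  unfolding grammar_forest_generates supertype_forest_def
  using generates_up_iff_subtype t_bot by (auto simp: generates_Start_iff)

end

section \<open>Choice of fresh names and the two inclusions\<close>

lemma forest_in_NCF_GNF:
  fixes \<Delta> :: "('a :: infinite) class_table"
  assumes "conforms_XM \<Delta>" "t_bot \<in> ground_terms (classes \<Delta>)" "\<Sigma> \<subseteq>\<^sub>m classes \<Delta>"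
  shows "supertype_forest \<Delta> t_bot \<Sigma> \<in> NCF_GNF"
proof -
  interpret noncontravariant_table \<Delta>
    by unfold_locales (rule assms)
  let ?N = "insert Start (Up ` dom \<Delta> \<union> Exact ` dom \<Delta>)"
  \<comment> \<open>An infinite symbol type leaves enough names outside the finitely many
    classes.\<close>
  have "infinite (- dom \<Delta>)"
    using finite_dom infinite_UNIV by (metis finite_compl)
  from infinite_arbitrarily_large[OF this, of "card ?N"]
  obtain B where B: "finite B" "card B = card ?N" "B \<subseteq> - dom \<Delta>"
    by blast
  have "finite ?N" using finite_dom by simp
  then obtain name where name: "name ` ?N \<subseteq> B" "inj_on name ?N"
    using card_le_inj[of ?N B] B(1,2) by (metis le_refl)
  interpret table_grammar \<Delta> t_bot \<Sigma> name
    using name(2) assms(2,3) disjoint_eq_subset_Compl[THEN iffD2, OF subset_trans[OF name(1) B(3)]]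
    by unfold_locales
  show ?thesis
    unfolding NCF_GNF_def using grammar_forest_grammar cf_grammar gnf_grammar by blast
qed

theorem corollary5p7:
  shows "(forests_XM :: ('a :: infinite) trm set set) = NCF_GNF"
proof
  show "(forests_XM :: 'a trm set set) \<subseteq> NCF_GNF"
    using forest_in_NCF_GNF by (auto simp: forests_XM_def)
  show "(NCF_GNF :: 'a trm set set) \<subseteq> forests_XM"
    unfolding NCF_GNF_def
    by (auto intro!: gnf_grammar.grammar_forest_in_forests_XM gnf_grammar.intro cf_grammar.intro
        gnf_grammar_axioms.intro)
qed

end
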